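(* Let $p$ be analytic in $\mathbb{D}$ with $p(0)=1$. For $\varphi_{e}(z):=e^z$, let the differential subordination $$p(z)+\beta zp'(z)\prec\varphi_{e}(z),\qquad \beta>0,$$ hold. Then $p(z)\prec\varphi_{Ne}(z)$ whenever $\beta\ge\beta_e\approx1.14016$, where $\varphi_{Ne}(z)=1+z-z^3/3$ and $\beta_e$ is the unique solution in $(0,\infty)$ of $$\sum_{j=0}^\infty\frac{1}{j!\,(1+j\beta)}-\frac53=0.$$ The estimate on $\beta$ cannot be improved further.
   Context: $\mathbb{D}=\{z\in\mathbb{C}:|z|<1\}$. For $f$ analytic on $\mathbb{D}$ and $g$ univalent (analytic and injective) on $\mathbb{D}$, $f$ is subordinate to $g$, written $f\prec g$ (or $f(z)\prec g(z)$), if and only if $f(0)=g(0)$ and $f(\mathbb{D})\subset g(\mathbb{D})$. The functions $e^z$ and $\varphi_{Ne}(z)=1+z-z^3/3$ are univalent on $\mathbb{D}$.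
   Formalization: The printed value 1.14016 of β_e is inaccurate: the unique positive solution of the stated equation is about 1.13915; the formal statement keeps the equation exactly and asserts only |β_e − 1.14016| < 0.0011. *)

theory Defs
  imports "HOL-Complex_Analysis.Complex_Analysis"
begin

abbreviation unit_disc :: "complex set" where
  "unit_disc \<equiv> ball 0 1"

definition univalent :: "(complex \<Rightarrow> complex) \<Rightarrow> bool" where
  "univalent g \<longleftrightarrow> g holomorphic_on unit_disc \<and> inj_on g unit_disc"

(* Subordination is only defined for f analytic and g univalent on the disc; these conditions
   are part of the predicate.  For the two superordinate functions below, univalence is proved,
   so a negated subordination never holds merely because of a failing side condition on g. *)
definition subordinate :: "(complex \<Rightarrow> complex) \<Rightarrow> (complex \<Rightarrow> complex) \<Rightarrow> bool"
    (infix "\<prec>" 50) where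
  "f \<prec> g \<longleftrightarrow> f holomorphic_on unit_disc \<and> univalent g \<and>
     f 0 = g 0 \<and> f ` unit_disc \<subseteq> g ` unit_disc"

definition phi_e :: "complex \<Rightarrow> complex" where
  "phi_e z = exp z"

definition phi_Ne :: "complex \<Rightarrow> complex" where
  "phi_Ne z = 1 + z - z ^ 3 / 3"

(* The series converges for every b \<ge> 0, so suminf is its genuine value there; it is only
   used for b > 0.  The positive root of beta_series b = 5/3 is 1.13915...; the value 1.14016
   quoted in the literature is correct only up to about 0.00101. *)
definition beta_series :: "real \<Rightarrow> real" where
  "beta_series b = (\<Sum>j. 1 / (fact j * (1 + real j * b)))"

lemma summable_beta_series:
  assumes "b \<ge> 0"
  shows "summable (\<lambda>j. 1 / (fact j * (1 + real j * b)))"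
proof (rule summable_comparison_test')
  show "summable (\<lambda>j. inverse (fact j) :: real)"
    using summable_exp[of "1::real"] by simp
  show "norm (1 / (fact j * (1 + real j * b))) \<le> inverse (fact j)" if "j \<ge> 0" for j
  proof -
    have "fact j * 1 \<le> (fact j * (1 + real j * b) :: real)"
      using assms by (intro mult_left_mono) auto
    then show ?thesis
      using assms by (simp add: inverse_eq_divide frac_le)
  qed
qed

lemma univalent_phi_e: "univalent phi_e"
  unfolding univalent_def phi_e_def
proof
  show "exp holomorphic_on unit_disc"
    by (intro holomorphic_intros)
  have "inj_on exp (ball (0::complex) pi)"
    by (rule inj_on_exp_pi)
  moreover have "unit_disc \<subseteq> ball 0 pi"
    using pi_gt3 by (intro subset_ball) simp
  ultimately show "inj_on exp unit_disc"
    by (rule inj_on_subset)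
qed

lemma univalent_phi_Ne: "univalent phi_Ne"
  unfolding univalent_def
proof
  show "phi_Ne holomorphic_on unit_disc"
    unfolding phi_Ne_def by (intro holomorphic_intros) auto
  show "inj_on phi_Ne unit_disc"
  proof (rule inj_onI)
    fix x y assume xy: "x \<in> unit_disc" "y \<in> unit_disc" and eq: "phi_Ne x = phi_Ne y"
    have x1: "cmod x < 1" and y1: "cmod y < 1"
      using xy by auto
    have prod1: "cmod (u * v) < 1" if "cmod u < 1" "cmod v < 1" for u v
      using mult_strict_mono'[of "cmod u" 1 "cmod v" 1] that by (simp add: norm_mult)
    have "cmod (x\<^sup>2) < 1" "cmod (y\<^sup>2) < 1" "cmod (x * y) < 1"
      using prod1 x1 y1 by (auto simp only: power2_eq_square)
    then have "cmod (x\<^sup>2 + x * y + y\<^sup>2) < 3"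
      using norm_triangle_ineq[of "x\<^sup>2 + x * y" "y\<^sup>2"] norm_triangle_ineq[of "x\<^sup>2" "x * y"]
      by linarith
    then have ne: "x\<^sup>2 + x * y + y\<^sup>2 \<noteq> 3"
      by auto
    have "(x - y) * (3 - (x\<^sup>2 + x * y + y\<^sup>2)) = 3 * (phi_Ne x - phi_Ne y)"
      unfolding phi_Ne_def by (simp add: field_simps power2_eq_square power3_eq_cube)
    then show "x = y"
      using ne eq by simp
  qed
qed

end

theory Submission
  imports Defs
begin

text \<open>
  Writing \<open>P z = p z + \<beta> z p' z\<close>, the function \<open>p\<close> is recovered from \<open>P\<close> by averaging along a
  radius, \<open>p z = \<integral>\<^sub>0\<^sup>1 P (t powr \<beta> * z) dt\<close>, because \<open>t \<mapsto> t * p (t powr \<beta> * z)\<close> has derivative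
  \<open>P (t powr \<beta> * z)\<close>.  For \<open>P = exp\<close> the solution is
  \<open>q z = (\<Sum>j. z ^ j / (j! (1 + j \<beta>)))\<close>, so \<open>q 1 = beta_series \<beta>\<close>.

  If \<open>P\<close> is subordinate to \<open>exp\<close>, then \<open>P = exp \<circ> w\<close> with a Schwarz function \<open>w\<close>, whence
  \<open>\<bar>P z - 1\<bar> \<le> exp \<bar>w z\<bar> - 1 \<le> exp \<bar>z\<bar> - 1\<close>.  Averaging this bound gives
  \<open>\<bar>p z - 1\<bar> \<le> q \<bar>z\<bar> - 1 \<le> \<bar>z\<bar> (q 1 - 1)\<close>.  On the other hand the largest disc centred at \<open>1\<close>
  inside the nephroid \<open>phi_Ne ` unit_disc\<close> has radius \<open>2/3\<close>: the nephroid has inward cusps at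
  \<open>1/3\<close> and \<open>5/3\<close>.  So the subordination holds as soon as \<open>q 1 \<le> 5/3\<close>, that is, as soon as
  \<open>\<beta> \<ge> \<beta>\<^sub>e\<close>, since \<open>beta_series\<close> is strictly decreasing.

  The bound is attained at the cusp \<open>5/3\<close>: for \<open>\<beta> < \<beta>\<^sub>e\<close> the function \<open>q\<close> itself takes real values
  above \<open>5/3\<close> on the disc, while by symmetry in the real axis all real points of the nephroid are
  values of \<open>phi_Ne\<close> at real points of the disc, and those stay below \<open>5/3\<close>.
\<close>

section \<open>The extremal function\<close>

text \<open>The power series of the average \<open>\<integral>\<^sub>0\<^sup>1 exp (t powr b * z) dt\<close> of \<open>exp\<close> along a radius.  Both the
  complex function and its restriction to the real line are needed, hence the polymorphic type.\<close>

definition expavg :: "real \<Rightarrow> 'a::{real_normed_field,banach} \<Rightarrow> 'a" where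
  "expavg b z = (\<Sum>j. of_real (1 / (fact j * (1 + real j * b))) * z ^ j)"

lemma expavg_one: "expavg b 1 = beta_series b"
  by (simp add: expavg_def beta_series_def)

lemma expavg_zero [simp]: "expavg b 0 = 1"
  unfolding expavg_def by (subst powser_zero) simp

lemma summable_expavg:
  fixes z :: "'a::{real_normed_field,banach}"
  assumes "b \<ge> 0"
  shows "summable (\<lambda>j. of_real (1 / (fact j * (1 + real j * b))) * z ^ j)"
proof (rule summable_comparison_test')
  show "summable (\<lambda>j. inverse (fact j) * norm z ^ j)"
    by (rule summable_exp)
  show "norm (of_real (1 / (fact j * (1 + real j * b))) * z ^ j) \<le> inverse (fact j) * norm z ^ j"
    if "j \<ge> 0" for j
  proof -
    have "fact j * 1 \<le> (fact j * (1 + real j * b) :: real)"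
      using assms by (intro mult_left_mono) auto
    then have "1 / (fact j * (1 + real j * b)) \<le> inverse (fact j)"
      using assms by (simp add: inverse_eq_divide frac_le)
    moreover have "norm (of_real (1 / (fact j * (1 + real j * b))) :: 'a)
        = 1 / (fact j * (1 + real j * b))"
      using assms by (simp only: norm_of_real) simp
    ultimately show ?thesis
      by (simp only: norm_mult norm_power) (intro mult_right_mono, auto)
  qed
qed

lemma expavg_of_real:
  assumes "b \<ge> 0"
  shows "expavg b (complex_of_real x) = complex_of_real (expavg b x)"
  unfolding expavg_def
  using suminf_of_real[OF summable_expavg[OF assms, of x], where 'a = complex] by simp

text \<open>Comparing coefficients: the factor \<open>1 + j b\<close> in the denominator is what the operator
  \<open>q \<mapsto> q + b z q'\<close> multiplies the coefficient of \<open>z ^ j\<close> with.\<close>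

lemma expavg_ode:
  fixes z :: "'a::{real_normed_field,banach}"
  assumes "b \<ge> 0"
  obtains D where "(expavg b has_field_derivative D) (at z)"
    and "expavg b z + of_real b * z * D = exp z"
proof
  define c :: "nat \<Rightarrow> 'a" where "c j = of_real (1 / (fact j * (1 + real j * b)))" for j
  have sm: "summable (\<lambda>j. c j * y ^ j)" for y
    unfolding c_def by (rule summable_expavg[OF assms])
  have q: "expavg b = (\<lambda>y. \<Sum>j. c j * y ^ j)"
    by (rule ext) (simp add: expavg_def c_def)
  let ?D = "\<Sum>j. diffs c j * z ^ j"
  show "(expavg b has_field_derivative ?D) (at z)"
    unfolding q by (rule termdiffs_strong_converges_everywhere[OF sm])
  have "summable (\<lambda>j. diffs c j * z ^ j)"
    by (rule termdiff_converges_all[OF sm])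
  from diffs_equiv[OF this]
  have "(\<lambda>j. of_real b * z * (of_nat j * c j * z ^ (j - Suc 0))) sums (of_real b * z * ?D)"
    by (rule sums_mult)
  with summable_sums[OF sm[of z]]
  have "(\<lambda>j. c j * z ^ j + of_real b * z * (of_nat j * c j * z ^ (j - Suc 0)))
      sums (expavg b z + of_real b * z * ?D)"
    unfolding q by (rule sums_add)
  moreover have "c j * z ^ j + of_real b * z * (of_nat j * c j * z ^ (j - Suc 0))
      = z ^ j /\<^sub>R fact j" for j
  proof -
    have "1 + real j * b > 0"
      using assms by (simp add: add_pos_nonneg)
    then have "1 / (fact j * (1 + real j * b)) * (1 + real j * b) = inverse (fact j)"
      by (simp add: inverse_eq_divide)
    then have "c j * of_real (1 + real j * b) = of_real (inverse (fact j))"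
      unfolding c_def by (simp only: flip: of_real_mult)
    moreover have "c j * z ^ j + of_real b * z * (of_nat j * c j * z ^ (j - Suc 0))
        = c j * of_real (1 + real j * b) * z ^ j"
      by (cases j) (auto simp: algebra_simps)
    ultimately show ?thesis
      by (simp only: scaleR_conv_of_real)
  qed
  ultimately show "expavg b z + of_real b * z * ?D = exp z"
    using exp_converges[of z] by (simp only:) (rule sums_unique2)
qed

lemma isCont_expavg:
  fixes z :: "'a::{real_normed_field,banach}"
  assumes "b \<ge> 0"
  shows "isCont (expavg b) z"
proof -
  obtain D where "(expavg b has_field_derivative D) (at z)"
    using assms by (rule expavg_ode)
  then show ?thesis
    by (rule DERIV_isCont)
qed

text \<open>All powers of \<open>r\<close> beyond the constant term are at most \<open>r\<close>; this turns a bound at \<open>1\<close> into a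
  strict bound inside the disc.\<close>

lemma expavg_minus_one_le:
  assumes "b \<ge> 0" "0 \<le> r" "r \<le> 1"
  shows "expavg b r - 1 \<le> r * (beta_series b - 1)"
proof -
  define c where "c j = 1 / (fact j * (1 + real j * b))" for j
  have c0: "c j \<ge> 0" for j
    using assms by (simp add: c_def)
  have sm: "summable (\<lambda>j. c j * y ^ j)" for y :: real
    using summable_expavg[OF assms(1), of y] by (simp add: c_def)
  have tail: "(\<Sum>j. c (Suc j) * y ^ Suc j) = expavg b y - 1" for y :: real
    using suminf_split_head[OF sm[of y]] by (simp add: expavg_def c_def)
  have sm': "summable (\<lambda>j. c (Suc j) * y ^ Suc j)" for y :: real
    using sm[of y] by (subst summable_Suc_iff)
  have "expavg b r - 1 \<le> (\<Sum>j. r * (c (Suc j) * 1 ^ Suc j))"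
    unfolding tail[symmetric]
  proof (intro suminf_le sm' summable_mult)
    fix j
    have "r ^ Suc j \<le> r"
      using assms power_decreasing[of 1 "Suc j" r] by simp
    then show "c (Suc j) * r ^ Suc j \<le> r * (c (Suc j) * 1 ^ Suc j)"
      using mult_left_mono[OF _ c0, of "r ^ Suc j" r "Suc j"] by (simp add: mult_ac)
  qed
  also have "\<dots> = r * (expavg b 1 - 1)"
    by (subst suminf_mult[OF sm']) (simp only: tail)
  finally show ?thesis
    by (simp add: expavg_one)
qed

section \<open>The critical parameter\<close>

lemma continuous_on_beta_series: "continuous_on {0..} beta_series"
proof -
  have "uniform_limit {0..} (\<lambda>n b. \<Sum>j<n. 1 / (fact j * (1 + real j * b)))
      (\<lambda>b. \<Sum>j. 1 / (fact j * (1 + real j * b))) sequentially"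
  proof (rule Weierstrass_m_test)
    show "summable (\<lambda>j. inverse (fact j) :: real)"
      using summable_exp[of "1::real"] by simp
    fix j :: nat and b :: real
    assume b: "b \<in> {0..}"
    then have "fact j * 1 \<le> (fact j * (1 + real j * b) :: real)"
      by (intro mult_left_mono) auto
    with b show "norm (1 / (fact j * (1 + real j * b))) \<le> inverse (fact j)"
      by (simp add: inverse_eq_divide frac_le)
  qed
  moreover have "continuous_on {0..} (\<lambda>b. \<Sum>j<n. 1 / (fact j * (1 + real j * b)))" for n
  proof (intro continuous_intros ballI)
    fix j :: nat and b :: real
    assume "b \<in> {0..}"
    then have "1 + real j * b > 0"
      by (simp add: add_pos_nonneg)
    then show "fact j * (1 + real j * b) \<noteq> 0"
      by simp
  qed
  ultimately show ?thesis
    unfolding beta_series_def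
    by (intro uniform_limit_theorem[where F = sequentially]) auto
qed

lemma beta_series_strict_antimono:
  assumes "0 \<le> a" "a < b"
  shows "beta_series b < beta_series a"
proof -
  let ?t = "\<lambda>b j. 1 / (fact j * (1 + real j * b)) :: real"
  have sm: "summable (?t a)" "summable (?t b)"
    using assms by (auto intro: summable_beta_series)
  have "0 < (\<Sum>j. ?t a j - ?t b j)"
  proof (rule suminf_pos2[where i = 1])
    show "summable (\<lambda>j. ?t a j - ?t b j)"
      by (intro summable_diff sm)
    show "0 \<le> ?t a j - ?t b j" for j
    proof -
      have "real j * a \<le> real j * b"
        using assms by (intro mult_left_mono) auto
      moreover have "1 + real j * a > 0"
        using assms by (simp add: add_pos_nonneg)
      ultimately show ?thesis
        by (simp add: frac_le)
    qed
    show "0 < ?t a 1 - ?t b 1"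
      using assms by (simp add: frac_less2)
  qed
  then show ?thesis
    by (simp add: beta_series_def suminf_diff[OF sm, symmetric])
qed

text \<open>The two evaluation points are \<open>1.14016 - 0.0011\<close> and \<open>1.14016 + 0.0011\<close>.  The root is close to
  \<open>1.13915\<close>, so the lower one leaves a margin of about \<open>0.00003\<close> only: six terms of the series
  are too few, seven suffice.\<close>

lemma beta_series_lower: "beta_series 1.13906 > 5 / 3"
proof -
  have "5 / 3 < (\<Sum>j<7. 1 / (fact j * (1 + real j * 1.13906)) :: real)"
    by (simp add: lessThan_nat_numeral fact_numeral)
  also have "\<dots> < beta_series 1.13906"
    unfolding beta_series_def
    by (intro sum_less_suminf summable_beta_series) auto
  finally show ?thesis .
qed

text \<open>In the tail from \<open>j = 7\<close> on, the factor \<open>1 / (1 + j b)\<close> is at most \<open>1/8\<close>, so the tail is at most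
  an eighth of the corresponding tail of the series of \<open>exp 1\<close>.\<close>

lemma beta_series_upper: "beta_series 1.14126 < 5 / 3"
proof -
  let ?t = "\<lambda>j. 1 / (fact j * (1 + real j * 1.14126)) :: real"
  have sm: "summable ?t"
    by (rule summable_beta_series) simp
  have sme: "summable (\<lambda>j. inverse (fact j) :: real)"
    using summable_exp[of "1::real"] by simp
  have "exp 1 = (\<Sum>j. inverse (fact j) :: real)"
    by (simp add: exp_def)
  also have "\<dots> = (\<Sum>j. inverse (fact (j + 7))) + (\<Sum>j<7. inverse (fact j))"
    by (rule suminf_split_initial_segment[OF sme])
  finally have etail: "(\<Sum>j. inverse (fact (j + 7)) :: real) < 0.003"
    using e_less_272 by (simp add: lessThan_nat_numeral fact_numeral)
  have "(\<Sum>j. ?t (j + 7)) \<le> (\<Sum>j. inverse (fact (j + 7)) / 8)"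
  proof (intro suminf_le)
    show "?t (j + 7) \<le> inverse (fact (j + 7)) / 8" for j
    proof -
      have "fact (j + 7) * 8 \<le> (fact (j + 7) * (1 + real (j + 7) * 1.14126) :: real)"
        by (intro mult_left_mono) auto
      then have "?t (j + 7) \<le> 1 / (fact (j + 7) * 8)"
        by (intro frac_le) auto
      then show ?thesis
        by (simp add: field_simps)
    qed
    show "summable (\<lambda>j. ?t (j + 7))"
      using sm by (rule summable_ignore_initial_segment)
    show "summable (\<lambda>j. inverse (fact (j + 7)) / 8 :: real)"
      by (intro summable_divide summable_ignore_initial_segment[OF sme])
  qed
  also have "\<dots> = (\<Sum>j. inverse (fact (j + 7))) / 8"
    by (intro suminf_divide summable_ignore_initial_segment[OF sme])
  finally have "(\<Sum>j. ?t (j + 7)) < 0.003 / 8"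
    using etail by simp
  moreover have "(\<Sum>j<7. ?t j) < 5 / 3 - 0.003 / 8"
    by (simp add: lessThan_nat_numeral fact_numeral)
  ultimately show ?thesis
    using suminf_split_initial_segment[OF sm, of 7] by (simp add: beta_series_def)
qed

lemma beta_series_root:
  obtains b where "1.13906 < b" "b < 1.14126" "beta_series b = 5 / 3"
proof -
  have "\<exists>b\<ge>1.13906. b \<le> 1.14126 \<and> beta_series b = 5 / 3"
    using beta_series_lower beta_series_upper
    by (intro IVT2' continuous_on_subset[OF continuous_on_beta_series]) auto
  then obtain b where b: "1.13906 \<le> b" "b \<le> 1.14126" "beta_series b = 5 / 3"
    by blast
  moreover have "b \<noteq> 1.13906" "b \<noteq> 1.14126"
    using b(3) beta_series_lower beta_series_upper by (metis less_irrefl)+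
  ultimately show ?thesis
    using that[of b] by linarith
qed

section \<open>The nephroid\<close>

text \<open>The equation \<open>phi_Ne z = w\<close> says that \<open>z\<close> is a fixed point of \<open>z \<mapsto> (w - 1) + z ^ 3 / 3\<close>.  This map
  sends the disc of radius \<open>r\<close> to itself when \<open>\<bar>w - 1\<bar> + r ^ 3 / 3 \<le> r\<close>, and \<open>r - r ^ 3 / 3\<close> increases to
  \<open>2/3\<close> as \<open>r\<close> tends to \<open>1\<close>.\<close>

lemma ball_subset_nephroid: "ball 1 (2 / 3) \<subseteq> phi_Ne ` unit_disc"
proof
  fix w :: complex
  assume "w \<in> ball 1 (2 / 3)"
  then have w: "norm (w - 1) < 2 / 3"
    by (simp add: dist_norm norm_minus_commute)
  have "\<exists>r\<ge>0. r \<le> 1 \<and> r - r ^ 3 / 3 = norm (w - 1)"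
    using w by (intro IVT') (auto intro!: continuous_intros)
  then obtain r where r: "0 \<le> r" "r \<le> 1" "r - r ^ 3 / 3 = norm (w - 1)"
    by blast
  then have r1: "r < 1"
    using w by (cases "r = 1") auto
  show "w \<in> phi_Ne ` unit_disc"
  proof (cases "r = 0")
    case True
    then have "w = phi_Ne 0"
      using r by (simp add: phi_Ne_def)
    then show ?thesis
      by (rule image_eqI) simp
  next
    case False
    then have "r > 0"
      using r(1) by simp
    have "(w - 1) + z ^ 3 / 3 \<in> cball 0 r" if "z \<in> cball 0 r" for z
    proof -
      have "norm (z ^ 3 / 3) \<le> r ^ 3 / 3"
        using that by (simp add: norm_divide norm_power power_mono)
      then show ?thesis
        using r(3) norm_triangle_ineq[of "w - 1" "z ^ 3 / 3"] by simp
    qed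
    then have "(\<lambda>z. (w - 1) + z ^ 3 / 3) \<in> cball 0 r \<rightarrow> cball 0 r"
      by (rule funcsetI)
    moreover have "continuous_on (cball 0 r) (\<lambda>z. (w - 1) + z ^ 3 / 3)"
      by (intro continuous_intros) auto
    ultimately obtain z where z: "z \<in> cball 0 r" "(w - 1) + z ^ 3 / 3 = z"
      using brouwer_ball[OF \<open>r > 0\<close>] by blast
    from z(2) have "w = phi_Ne z"
      by (simp add: phi_Ne_def algebra_simps)
    moreover have "z \<in> unit_disc"
      using z(1) r1 by simp
    ultimately show ?thesis
      by blast
  qed
qed

text \<open>Since \<open>phi_Ne\<close> is injective and commutes with complex conjugation, a preimage of a real point
  is real.\<close>

lemma real_in_nephroid_less:
  assumes "complex_of_real x \<in> phi_Ne ` unit_disc"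
  shows "x < 5 / 3"
proof -
  from assms obtain z where z: "z \<in> unit_disc" "complex_of_real x = phi_Ne z"
    by blast
  have "phi_Ne (cnj z) = cnj (phi_Ne z)"
    by (simp add: phi_Ne_def)
  also have "\<dots> = phi_Ne z"
    by (simp flip: z(2))
  finally have "cnj z = z"
    using univalent_phi_Ne z(1) by (auto simp: univalent_def dest: inj_onD)
  then have zr: "z = complex_of_real (Re z)"
    by (simp add: complex_eq_iff)
  define y where "y = Re z"
  have y: "\<bar>y\<bar> < 1"
    using z(1) abs_Re_le_cmod[of z] by (simp add: y_def)
  have "complex_of_real x = complex_of_real (1 + y - y ^ 3 / 3)"
    using z(2) zr by (simp add: phi_Ne_def y_def)
  then have x: "x = 1 + y - y ^ 3 / 3"
    by (simp only: of_real_eq_iff)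
  \<comment> \<open>\<open>phi_Ne - 5/3\<close> has a double zero at the cusp parameter \<open>1\<close>.\<close>
  have "0 < (1 - y) * (1 - y) * (y + 2)"
    using y by (intro mult_pos_pos) auto
  also have "\<dots> = 3 * (5 / 3 - x)"
    by (simp add: x algebra_simps power3_eq_cube)
  finally show ?thesis
    by simp
qed

section \<open>Bounds for subordinate functions and their averages\<close>

text \<open>Integrate \<open>w exp (t w)\<close> over \<open>t\<close> from \<open>0\<close> to \<open>1\<close>; its modulus is at most \<open>\<bar>w\<bar> exp (t \<bar>w\<bar>)\<close>.\<close>

lemma norm_exp_minus_one_le:
  fixes w :: complex
  shows "norm (exp w - 1) \<le> exp (norm w) - 1"
proof -
  have "norm (exp (of_real 1 * w) - exp (of_real 0 * w)) \<le> exp (1 * norm w) - exp (0 * norm w)"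
  proof (rule differentiable_bound_general)
    fix t :: real
    assume t: "0 < t" "t < 1"
    show "((\<lambda>t. exp (of_real t * w)) has_vector_derivative (w * exp (of_real t * w))) (at t)"
      by (rule derivative_eq_intros has_vector_derivative_real_field refl | simp)+
    show "((\<lambda>t. exp (t * norm w)) has_vector_derivative (norm w * exp (t * norm w))) (at t)"
      by (rule derivative_eq_intros refl has_real_derivative_iff_has_vector_derivative[THEN iffD1] | simp)+
    show "norm (w * exp (of_real t * w)) \<le> norm w * exp (t * norm w)"
      using t norm_exp[of "of_real t * w"] by (simp add: norm_mult mult_left_mono)
  qed (auto intro!: continuous_intros)
  then show ?thesis
    by simp
qed

text \<open>As \<open>exp\<close> is injective on the disc with inverse \<open>Ln\<close>, the function \<open>Ln \<circ> P\<close> maps the disc to itself and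
  fixes \<open>0\<close>, so that the Schwarz lemma applies to it.\<close>

lemma subordinate_exp_bound:
  assumes sub: "P \<prec> phi_e" and z: "norm z < 1"
  shows "norm (P z - 1) \<le> exp (norm z) - 1"
proof -
  have hol: "P holomorphic_on unit_disc" and P0: "P 0 = 1"
    and img: "P ` unit_disc \<subseteq> exp ` unit_disc"
    using sub by (auto simp: subordinate_def phi_e_def)
  have Pu: "\<exists>u. norm u < 1 \<and> P x = exp u" if "norm x < 1" for x
  proof -
    have "P x \<in> exp ` unit_disc"
      using img that by (auto simp: image_subset_iff)
    then show ?thesis
      by auto
  qed
  have Ln_exp_disc: "Ln (exp u) = u" if "norm u < 1" for u
    using that abs_Im_le_cmod[of u] pi_gt3 by (intro Ln_exp) auto
  have nonneg: "P x \<notin> \<real>\<^sub>\<le>\<^sub>0" if x: "x \<in> unit_disc" for x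
  proof -
    obtain u where u: "norm u < 1" "P x = exp u"
      using Pu[of x] x by auto
    then have "\<bar>Im u\<bar> < pi / 2"
      using abs_Im_le_cmod[of u] pi_gt3 by linarith
    then have "Re (P x) > 0"
      using u(2) cos_gt_zero_pi[of "Im u"] by (simp add: Re_exp)
    then show ?thesis
      by (auto simp: complex_nonpos_Reals_iff)
  qed
  define w where "w x = Ln (P x)" for x
  have wP: "norm (w x) < 1 \<and> P x = exp (w x)" if "norm x < 1" for x
    using Pu[OF that] Ln_exp_disc by (auto simp: w_def)
  have "w holomorphic_on unit_disc"
    unfolding w_def using hol nonneg by (intro holomorphic_intros) auto
  moreover have "w 0 = 0"
    by (simp add: w_def P0)
  ultimately have "norm (w z) \<le> norm z"
    using wP z by (intro Schwarz_Lemma(1)) auto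
  have "norm (P z - 1) \<le> exp (norm (w z)) - 1"
    using wP[OF z] norm_exp_minus_one_le[of "w z"] by simp
  also have "\<dots> \<le> exp (norm z) - 1"
    using \<open>norm (w z) \<le> norm z\<close> by simp
  finally show ?thesis .
qed

text \<open>The factor \<open>t\<close> turns the radial differential operator into an exact derivative, because
  \<open>t * (t powr \<beta>)' = \<beta> * t powr \<beta>\<close>.\<close>

lemma has_vector_derivative_radial:
  fixes z :: "'a::real_normed_field"
  assumes t: "0 < t" and f: "(f has_field_derivative D) (at (of_real (t powr \<beta>) * z))"
  shows "((\<lambda>t. of_real t * f (of_real (t powr \<beta>) * z)) has_vector_derivative
      (f (of_real (t powr \<beta>) * z) + of_real \<beta> * (of_real (t powr \<beta>) * z) * D)) (at t)"
proof -
  have "((\<lambda>t. t powr \<beta>) has_real_derivative (\<beta> * t powr (\<beta> - 1))) (at t)"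
    using t by (rule has_real_derivative_powr)
  then have "((\<lambda>t. of_real (t powr \<beta>) * z) has_vector_derivative
      (of_real (\<beta> * t powr (\<beta> - 1)) * z)) (at t)"
    by (intro has_vector_derivative_mult_left has_vector_derivative_of_real)
  from field_vector_diff_chain_at[OF this f]
  have "((\<lambda>t. f (of_real (t powr \<beta>) * z)) has_vector_derivative
      (of_real (\<beta> * t powr (\<beta> - 1)) * z * D)) (at t)"
    by (simp add: o_def)
  moreover have "((\<lambda>t. of_real t) has_vector_derivative (of_real 1 :: 'a)) (at t)"
    by (intro has_vector_derivative_of_real DERIV_ident)
  ultimately have "((\<lambda>t. of_real t * f (of_real (t powr \<beta>) * z)) has_vector_derivative
      (of_real t * (of_real (\<beta> * t powr (\<beta> - 1)) * z * D)
        + of_real 1 * f (of_real (t powr \<beta>) * z))) (at t)"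
    by (intro has_vector_derivative_mult)
  moreover have "of_real t * (of_real (\<beta> * t powr (\<beta> - 1)) * z * D)
      = of_real \<beta> * (of_real (t powr \<beta>) * z) * D"
  proof -
    have "t * (\<beta> * t powr (\<beta> - 1)) = \<beta> * t powr \<beta>"
      using t powr_mult_base[of t "\<beta> - 1"] by (simp add: algebra_simps)
    then have "(of_real (t * (\<beta> * t powr (\<beta> - 1))) :: 'a) * z * D = of_real (\<beta> * t powr \<beta>) * z * D"
      by (simp only:)
    then show ?thesis
      by (simp only: of_real_mult mult.assoc)
  qed
  ultimately show ?thesis
    by (simp only: of_real_1 mult_1_left add.commute)
qed

text \<open>Averaging a majorant: both sides come from the mean value inequality for
  \<open>t \<mapsto> t * (p (t powr \<beta> * z) - 1)\<close> and \<open>t \<mapsto> t * (q (t powr \<beta> * \<bar>z\<bar>) - 1)\<close>, whose derivatives are compared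
  by the hypothesis.\<close>

lemma average_bound:
  assumes \<beta>: "\<beta> > 0" and hol: "p holomorphic_on unit_disc" and z: "norm z < 1"
    and bnd: "\<And>x. norm x < 1 \<Longrightarrow>
      norm (p x + complex_of_real \<beta> * x * deriv p x - 1) \<le> exp (norm x) - 1"
  shows "norm (p z - 1) \<le> expavg \<beta> (norm z) - 1"
proof -
  define f where "f t = of_real t * (p (of_real (t powr \<beta>) * z) - 1)" for t :: real
  define g where "g t = t * (expavg \<beta> (t powr \<beta> * norm z) - 1)" for t :: real
  have in_disc: "norm (of_real (t powr \<beta>) * z) < 1" if "0 \<le> t" "t \<le> 1" for t
  proof -
    have "t powr \<beta> \<le> 1"
      using that \<beta> powr_mono2[of \<beta> t 1] by simp
    then have "t powr \<beta> * norm z \<le> 1 * norm z"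
      by (intro mult_right_mono) auto
    then show ?thesis
      using z by (simp add: norm_mult)
  qed
  have cont_powr: "continuous_on {0..1} (\<lambda>t. t powr \<beta>)"
    using \<beta> by (intro continuous_on_powr' continuous_intros) auto
  have cont_q: "continuous_on UNIV (expavg \<beta> :: real \<Rightarrow> real)"
    by (intro continuous_at_imp_continuous_on ballI isCont_expavg) (use \<beta> in simp)
  have "norm (f 1 - f 0) \<le> g 1 - g 0"
  proof (rule differentiable_bound_general)
    show "continuous_on {0..1} f"
      unfolding f_def
      by (intro continuous_intros continuous_on_compose2[OF holomorphic_on_imp_continuous_on[OF hol]]
          cont_powr) (use in_disc in auto)
    show "continuous_on {0..1} g"
      unfolding g_def
      by (intro continuous_intros continuous_on_compose2[OF cont_q] cont_powr) auto
    fix t :: real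
    assume t: "0 < t" "t < 1"
    define x where "x = of_real (t powr \<beta>) * z"
    have x: "norm x < 1"
      using in_disc t by (simp add: x_def)
    have nx: "norm x = of_real (t powr \<beta>) * norm z"
      by (simp add: x_def norm_mult)
    have "(p has_field_derivative deriv p x) (at x)"
      using hol x by (intro holomorphic_derivI[of p unit_disc]) auto
    then have "((\<lambda>y. p y - 1) has_field_derivative deriv p x) (at x)"
      by (auto intro!: derivative_eq_intros)
    then show "(f has_vector_derivative (p x - 1 + of_real \<beta> * x * deriv p x)) (at t)"
      unfolding f_def x_def by (intro has_vector_derivative_radial t)
    obtain D where D: "(expavg \<beta> has_field_derivative D) (at (norm x))"
      and eq: "expavg \<beta> (norm x) + of_real \<beta> * norm x * D = exp (norm x)"
      using expavg_ode[of \<beta> "norm x"] \<beta> by auto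
    from D have "((\<lambda>y. expavg \<beta> y - 1) has_field_derivative D) (at (norm x))"
      by (auto intro!: derivative_eq_intros)
    then have "((\<lambda>t. of_real t * (expavg \<beta> (of_real (t powr \<beta>) * norm z) - 1)) has_vector_derivative
        (expavg \<beta> (norm x) - 1 + of_real \<beta> * norm x * D)) (at t)"
      unfolding nx by (intro has_vector_derivative_radial t)
    moreover have "expavg \<beta> (norm x) - 1 + of_real \<beta> * norm x * D = exp (norm x) - 1"
      using eq by simp
    ultimately have "((\<lambda>t. of_real t * (expavg \<beta> (of_real (t powr \<beta>) * norm z) - 1))
        has_vector_derivative (exp (norm x) - 1)) (at t)"
      by (simp only:)
    then show "(g has_vector_derivative (exp (norm x) - 1)) (at t)"
      by (simp add: g_def [abs_def])
    show "norm (p x - 1 + of_real \<beta> * x * deriv p x) \<le> exp (norm x) - 1"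
      using bnd[OF x] by (simp add: algebra_simps)
  qed simp
  then show ?thesis
    by (simp add: f_def g_def)
qed

section \<open>The sharp subordination\<close>

lemma subordinate_nephroid:
  assumes \<beta>: "\<beta> > 0" and crit: "beta_series \<beta> \<le> 5 / 3"
    and hol: "p holomorphic_on unit_disc" and p0: "p 0 = 1"
    and sub: "(\<lambda>z. p z + complex_of_real \<beta> * z * deriv p z) \<prec> phi_e"
  shows "p \<prec> phi_Ne"
proof -
  have "p z \<in> phi_Ne ` unit_disc" if z: "norm z < 1" for z
  proof -
    have "norm (p z - 1) \<le> expavg \<beta> (norm z) - 1"
      by (rule average_bound[OF \<beta> hol z subordinate_exp_bound[OF sub]])
    also have "\<dots> \<le> norm z * (beta_series \<beta> - 1)"
      using \<beta> z by (intro expavg_minus_one_le) auto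
    also have "\<dots> \<le> norm z * (2 / 3)"
      using crit by (intro mult_left_mono) auto
    also have "\<dots> < 2 / 3"
      using z by simp
    finally have "p z \<in> ball 1 (2 / 3)"
      by (simp add: dist_norm norm_minus_commute)
    then show ?thesis
      using ball_subset_nephroid by blast
  qed
  then show ?thesis
    using hol p0 univalent_phi_Ne by (auto simp: subordinate_def phi_Ne_def)
qed

lemma expavg_not_subordinate_nephroid:
  assumes \<beta>: "\<beta> \<ge> 0" and crit: "beta_series \<beta> > 5 / 3"
  shows "\<not> expavg \<beta> \<prec> phi_Ne"
proof
  assume sub: "expavg \<beta> \<prec> phi_Ne"
  have "isCont (expavg \<beta> :: real \<Rightarrow> real) 1"
    by (rule isCont_expavg[OF \<beta>])
  then have "(expavg \<beta> \<longlongrightarrow> beta_series \<beta>) (at_left 1)"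
    by (simp add: isCont_def expavg_one filterlim_at_split)
  then have "\<forall>\<^sub>F x in at_left 1. expavg \<beta> x > (5 / 3 :: real)"
    using crit by (rule order_tendstoD)
  moreover have "\<forall>\<^sub>F x in at_left 1. x \<in> {0<..<1::real}"
    by (rule eventually_at_left_real) simp
  ultimately have "\<forall>\<^sub>F x in at_left 1. expavg \<beta> x > 5 / 3 \<and> x \<in> {0<..<1::real}"
    by (rule eventually_conj)
  then obtain x :: real where x: "expavg \<beta> x > 5 / 3" "x \<in> {0<..<1}"
    using eventually_happens'[of "at_left (1::real)"] by force
  then have "complex_of_real x \<in> unit_disc"
    by simp
  then have "expavg \<beta> (complex_of_real x) \<in> phi_Ne ` unit_disc"
    using sub by (auto simp: subordinate_def)
  then have "expavg \<beta> x < 5 / 3"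
    unfolding expavg_of_real[OF \<beta>] by (rule real_in_nephroid_less)
  with x(1) show False
    by simp
qed

lemma expavg_extremal:
  assumes \<beta>: "\<beta> \<ge> 0"
  shows "expavg \<beta> holomorphic_on unit_disc"
    and "(\<lambda>z. expavg \<beta> z + complex_of_real \<beta> * z * deriv (expavg \<beta>) z) \<prec> phi_e"
proof -
  show "expavg \<beta> holomorphic_on unit_disc"
    unfolding holomorphic_on_open[OF open_ball] using expavg_ode[OF \<beta>] by blast
  have "expavg \<beta> z + complex_of_real \<beta> * z * deriv (expavg \<beta>) z = phi_e z" for z
  proof -
    obtain D where "(expavg \<beta> has_field_derivative D) (at z)"
      and "expavg \<beta> z + complex_of_real \<beta> * z * D = exp z"
      using \<beta> by (rule expavg_ode)
    then show ?thesis
      by (simp add: DERIV_imp_deriv phi_e_def)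
  qed
  then show "(\<lambda>z. expavg \<beta> z + complex_of_real \<beta> * z * deriv (expavg \<beta>) z) \<prec> phi_e"
    using univalent_phi_e by (simp add: subordinate_def univalent_def)
qed

theorem theorem3p3:
  shows "\<exists>\<beta>\<^sub>e::real.
    (\<beta>\<^sub>e > 0 \<and> beta_series \<beta>\<^sub>e - 5 / 3 = 0) \<and>
    (\<forall>b>0. beta_series b - 5 / 3 = 0 \<longrightarrow> b = \<beta>\<^sub>e) \<and>
    \<bar>\<beta>\<^sub>e - 1.14016\<bar> < 0.0011 \<and>
    (\<forall>\<beta>>0. \<beta> \<ge> \<beta>\<^sub>e \<longrightarrow>
      (\<forall>p. p holomorphic_on unit_disc \<and> p 0 = 1 \<and>
           (\<lambda>z. p z + complex_of_real \<beta> * z * deriv p z) \<prec> phi_e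
           \<longrightarrow> p \<prec> phi_Ne)) \<and>
    (\<forall>\<beta>>0. \<beta> < \<beta>\<^sub>e \<longrightarrow>
      (\<exists>p. p holomorphic_on unit_disc \<and> p 0 = 1 \<and>
           (\<lambda>z. p z + complex_of_real \<beta> * z * deriv p z) \<prec> phi_e \<and>
           \<not> p \<prec> phi_Ne))"
proof -
  obtain b where b: "1.13906 < b" "b < 1.14126" "beta_series b = 5 / 3"
    by (rule beta_series_root)
  have b0: "b > 0"
    using b by simp
  show ?thesis
  proof (intro exI[of _ b] conjI allI impI)
    show "b > 0" "beta_series b - 5 / 3 = 0"
      using b b0 by auto
    show "\<bar>b - 1.14016\<bar> < 0.0011"
      using b unfolding abs_less_iff by simp
    show "c = b" if "c > 0" "beta_series c - 5 / 3 = 0" for c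
      using that b b0 beta_series_strict_antimono[of b c] beta_series_strict_antimono[of c b]
      by (cases c b rule: linorder_cases) auto
    show "p \<prec> phi_Ne"
      if "\<beta> > 0" "\<beta> \<ge> b" "p holomorphic_on unit_disc \<and> p 0 = 1 \<and>
           (\<lambda>z. p z + complex_of_real \<beta> * z * deriv p z) \<prec> phi_e" for \<beta> p
    proof -
      have "beta_series \<beta> \<le> 5 / 3"
        using that b b0 beta_series_strict_antimono[of b \<beta>] by (cases "\<beta> = b") auto
      then show ?thesis
        using that by (intro subordinate_nephroid) auto
    qed
    show "\<exists>p. p holomorphic_on unit_disc \<and> p 0 = 1 \<and>
           (\<lambda>z. p z + complex_of_real \<beta> * z * deriv p z) \<prec> phi_e \<and> \<not> p \<prec> phi_Ne"
      if "\<beta> > 0" "\<beta> < b" for \<beta>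
    proof -
      have "beta_series \<beta> > 5 / 3"
        using that b beta_series_strict_antimono[of \<beta> b] by simp
      then have "\<not> expavg \<beta> \<prec> phi_Ne"
        using that by (intro expavg_not_subordinate_nephroid) auto
      then show ?thesis
        using that by (intro exI[of _ "expavg \<beta>"] conjI expavg_extremal) auto
    qed
  qed
qed

end
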